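(* Assume the state set $S$ is nonempty. Let $(\gamma,x_0)$ and $(\delta,y_0)$ be based cellular automata with $\gamma\colon X\to CX$, $\delta\colon Y\to CY$, and let $X^*\xleftarrow{p_1}R\xrightarrow{p_2}Y^*$ be a logical equivalence between them such that $p_2$ has a section $s_2\colon Y^*\to R$ (i.e. $p_2\circ s_2=\mathrm{id}$). Then there exist a cellular automaton $\rho\colon Q\to CQ$ on a subset $Q\subseteq X\times Y$ with $(x_0,y_0)\in Q$ such that the two restricted projections $q_1\colon Q\to X$, $q_2\colon Q\to Y$ are pre-cellular morphisms $\rho\to\gamma$ and $\rho\to\delta$, and a map $h\colon R\to \mathrm{Cons}$ with $\pi_k\circ h=p_k$ for $k=1,2$, where $(\rho,q,\mathrm{Cons},\pi,g)$ is the cellular bisimulation of consistent configurations of $(\rho,q)$.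
   Context: Fix a monoid $(M,\cdot,e)$, a subset $N\subseteq M$ with inclusion $i\colon N\hookrightarrow M$, and a set $S$ of states. $[A,B]$ denotes the set of maps $A\to B$. For $a\colon M\to X$ let $I^a\subseteq[N,S]$ be the set of $f\colon N\to S$ with $f(n)=f(n')$ whenever $a(i(n))=a(i(n'))$; for $h\colon X\to Y$, $I^{h\circ a}\subseteq I^a$. Let $CX=\coprod_{a\colon M\to X}[I^a,S]$, $(Ch)(a,f)=(h\circ a, f|_{I^{h\circ a}})$. A cellular automaton is $\gamma\colon X\to CX$, $\gamma(x)=(\gamma_1(x),\gamma_2(x))$ with $\gamma_1(x)\colon M\to X$, $\gamma_2(x)\colon I^{\gamma_1(x)}\to S$, such that $\gamma_1(x)(e)=x$ and $\gamma_1(\gamma_1(x)(m))(n)=\gamma_1(x)(n\cdot m)$. A pre-cellular morphism $h\colon\gamma\to\delta$ is a map $h$ of carriers with $Ch\circ\gamma=\delta\circ h$. Configurations: $X^*=[X,S]$; for $h\colon X\to Y$, $h^*(c)=c\circ h$. Global rule: $G_\gamma(c)(x)=\gamma_2(x)(c\circ\gamma_1(x)\circ i)$. A based cellular automaton is a pair $(\gamma,x_0)$ with $x_0$ a cell. A cellular bisimulation between $\gamma\colon X\to CX$ and $\delta\colon Y\to CY$ is a tuple $(\rho,q,R,p,g)$ where $\rho\colon Q\to CQ$ is a cellular automaton, $q_1\colon\rho\to\gamma$, $q_2\colon\rho\to\delta$ are pre-cellular morphisms, $R$ is a set with maps $p_1\colon R\to X^*$, $p_2\colon R\to Y^*$,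 and $g\colon R\to R$, such that $q_1^*\circ p_1=q_2^*\circ p_2$ and $p_1\circ g=G_\gamma\circ p_1$, $p_2\circ g=G_\delta\circ p_2$. For such $(\rho,q)$, the consistent configurations are $\mathrm{Cons}=\{(c_1,c_2)\in X^*\times Y^*: c_1\circ q_1=c_2\circ q_2\}$ with projections $\pi_1,\pi_2$ and $g(c_1,c_2)=(G_\gamma(c_1),G_\delta(c_2))$; $(\rho,q,\mathrm{Cons},\pi,g)$ is a cellular bisimulation. Modal formulas: $\varphi::=s\mid\neg\varphi\mid\bigvee_{j\in J}\varphi_j\mid\langle m\rangle\varphi\mid\bigcirc\varphi$ ($s\in S$, $m\in M$, $J$ arbitrary). Semantics: $(\gamma,x,c)\models s$ iff $c(x)=s$; $\neg,\bigvee$ classical; $(\gamma,x,c)\models\langle m\rangle\varphi$ iff $(\gamma,\gamma_1(x)(m),c)\models\varphi$; $(\gamma,x,c)\models\bigcirc\varphi$ iff $(\gamma,x,G_\gamma(c))\models\varphi$. A logical equivalence between $(\gamma,x_0)$ and $(\delta,y_0)$ is a span $X^*\xleftarrow{p_1}R\xrightarrow{p_2}Y^*$ such that for all $r\in R$ and formulas $\varphi$: $(\gamma,x_0,p_1(r))\models\varphi$ iff $(\delta,y_0,p_2(r))\models\varphi$. *)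

theory Defs
  imports "HOL-Library.FuncSet"
begin

text \<open>
  The monoid is a type of class \<open>monoid_mult\<close> and the states form a type (hence there is
  at least one state).  Sets of cells are carrier sets, because an automaton has to be
  constructed on a subset of a product.  A map with domain \<open>A\<close> whose equality with other maps
  matters is an element of a set \<open>A \<rightarrow>\<^sub>E B\<close>, i.e. it is normalised outside \<open>A\<close>.
\<close>

type_synonym ('x, 'm, 's) local_structure = "('m \<Rightarrow> 'x) \<times> (('m \<Rightarrow> 's) \<Rightarrow> 's)"

definition local_configs :: "'m set \<Rightarrow> ('m \<Rightarrow> 'x) \<Rightarrow> ('m \<Rightarrow> 's) set" where
  "local_configs N a =
     {f \<in> N \<rightarrow>\<^sub>E UNIV. \<forall>n\<in>N. \<forall>n'\<in>N. a n = a n' \<longrightarrow> f n = f n'}"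

definition C_obj :: "'m set \<Rightarrow> 'x set \<Rightarrow> ('x, 'm, 's) local_structure set" where
  "C_obj N X = (SIGMA a : UNIV \<rightarrow> X. local_configs N a \<rightarrow>\<^sub>E UNIV)"

definition C_map ::
  "'m set \<Rightarrow> ('x \<Rightarrow> 'y) \<Rightarrow> ('x, 'm, 's) local_structure \<Rightarrow> ('y, 'm, 's) local_structure" where
  "C_map N h = (\<lambda>(a, f). (h \<circ> a, restrict f (local_configs N (h \<circ> a))))"

definition cellular_automaton ::
  "'m::monoid_mult set \<Rightarrow> 'x set \<Rightarrow> ('x \<Rightarrow> ('x, 'm, 's) local_structure) \<Rightarrow> bool" where
  "cellular_automaton N X \<gamma> \<longleftrightarrow>
     \<gamma> \<in> X \<rightarrow> C_obj N X \<and>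
     (\<forall>x\<in>X. fst (\<gamma> x) 1 = x) \<and>
     (\<forall>x\<in>X. \<forall>m n. fst (\<gamma> (fst (\<gamma> x) m)) n = fst (\<gamma> x) (n * m))"

definition based_cellular_automaton ::
  "'m::monoid_mult set \<Rightarrow> 'x set \<Rightarrow> ('x \<Rightarrow> ('x, 'm, 's) local_structure) \<Rightarrow> 'x \<Rightarrow> bool" where
  "based_cellular_automaton N X \<gamma> x\<^sub>0 \<longleftrightarrow> cellular_automaton N X \<gamma> \<and> x\<^sub>0 \<in> X"

definition pre_cellular_morphism ::
  "'m set \<Rightarrow> 'x set \<Rightarrow> ('x \<Rightarrow> ('x, 'm, 's) local_structure) \<Rightarrow>
   'y set \<Rightarrow> ('y \<Rightarrow> ('y, 'm, 's) local_structure) \<Rightarrow> ('x \<Rightarrow> 'y) \<Rightarrow> bool" where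
  "pre_cellular_morphism N X \<gamma> Y \<delta> h \<longleftrightarrow>
     h \<in> X \<rightarrow> Y \<and> (\<forall>x\<in>X. C_map N h (\<gamma> x) = \<delta> (h x))"

definition configs :: "'x set \<Rightarrow> ('x \<Rightarrow> 's) set" where
  "configs X = X \<rightarrow>\<^sub>E UNIV"

definition pullback_config :: "'x set \<Rightarrow> ('x \<Rightarrow> 'y) \<Rightarrow> ('y \<Rightarrow> 's) \<Rightarrow> ('x \<Rightarrow> 's)" where
  "pullback_config X h c = compose X c h"

definition global_rule ::
  "'m set \<Rightarrow> 'x set \<Rightarrow> ('x \<Rightarrow> ('x, 'm, 's) local_structure) \<Rightarrow> ('x \<Rightarrow> 's) \<Rightarrow> ('x \<Rightarrow> 's)" where
  "global_rule N X \<gamma> c = (\<lambda>x\<in>X. snd (\<gamma> x) (\<lambda>n\<in>N. c (fst (\<gamma> x) n)))"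

definition cellular_bisimulation ::
  "'m::monoid_mult set \<Rightarrow>
   'x set \<Rightarrow> ('x \<Rightarrow> ('x, 'm, 's) local_structure) \<Rightarrow>
   'y set \<Rightarrow> ('y \<Rightarrow> ('y, 'm, 's) local_structure) \<Rightarrow>
   'q set \<Rightarrow> ('q \<Rightarrow> ('q, 'm, 's) local_structure) \<Rightarrow> ('q \<Rightarrow> 'x) \<Rightarrow> ('q \<Rightarrow> 'y) \<Rightarrow>
   'r set \<Rightarrow> ('r \<Rightarrow> 'x \<Rightarrow> 's) \<Rightarrow> ('r \<Rightarrow> 'y \<Rightarrow> 's) \<Rightarrow> ('r \<Rightarrow> 'r) \<Rightarrow> bool" where
  "cellular_bisimulation N X \<gamma> Y \<delta> Q \<rho> q\<^sub>1 q\<^sub>2 R p\<^sub>1 p\<^sub>2 g \<longleftrightarrow>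
     cellular_automaton N Q \<rho> \<and>
     pre_cellular_morphism N Q \<rho> X \<gamma> q\<^sub>1 \<and>
     pre_cellular_morphism N Q \<rho> Y \<delta> q\<^sub>2 \<and>
     p\<^sub>1 \<in> R \<rightarrow> configs X \<and> p\<^sub>2 \<in> R \<rightarrow> configs Y \<and> g \<in> R \<rightarrow> R \<and>
     (\<forall>r\<in>R. pullback_config Q q\<^sub>1 (p\<^sub>1 r) = pullback_config Q q\<^sub>2 (p\<^sub>2 r)) \<and>
     (\<forall>r\<in>R. p\<^sub>1 (g r) = global_rule N X \<gamma> (p\<^sub>1 r)) \<and>
     (\<forall>r\<in>R. p\<^sub>2 (g r) = global_rule N Y \<delta> (p\<^sub>2 r))"

definition consistent_configs ::
  "'x set \<Rightarrow> 'y set \<Rightarrow> 'q set \<Rightarrow> ('q \<Rightarrow> 'x) \<Rightarrow> ('q \<Rightarrow> 'y) \<Rightarrow> (('x \<Rightarrow> 's) \<times> ('y \<Rightarrow> 's)) set" where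
  "consistent_configs X Y Q q\<^sub>1 q\<^sub>2 =
     {(c\<^sub>1, c\<^sub>2) \<in> configs X \<times> configs Y. pullback_config Q q\<^sub>1 c\<^sub>1 = pullback_config Q q\<^sub>2 c\<^sub>2}"

text \<open>
  A disjunction is indexed by an arbitrary, possibly empty or infinite, set \<open>J\<close> of elements of
  \<open>'j\<close>; the values of the family outside \<open>J\<close> are irrelevant.  The datatype exists for every
  index type \<open>'j\<close>.
\<close>

datatype ('j, 'm, 's) modal_formula =
    State 's
  | Neg "('j, 'm, 's) modal_formula"
  | Disj "'j set" "'j \<Rightarrow> ('j, 'm, 's) modal_formula"
  | Dia 'm "('j, 'm, 's) modal_formula"
  | Next "('j, 'm, 's) modal_formula"

primrec satisfies ::
  "'m set \<Rightarrow> 'x set \<Rightarrow> ('x \<Rightarrow> ('x, 'm, 's) local_structure) \<Rightarrow> 'x \<Rightarrow> ('x \<Rightarrow> 's) \<Rightarrow>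
   ('j, 'm, 's) modal_formula \<Rightarrow> bool" where
  "satisfies N X \<gamma> x c (State s) \<longleftrightarrow> c x = s"
| "satisfies N X \<gamma> x c (Neg \<phi>) \<longleftrightarrow> \<not> satisfies N X \<gamma> x c \<phi>"
| "satisfies N X \<gamma> x c (Disj J \<Phi>) \<longleftrightarrow> (\<exists>j\<in>J. satisfies N X \<gamma> x c (\<Phi> j))"
| "satisfies N X \<gamma> x c (Dia m \<phi>) \<longleftrightarrow> satisfies N X \<gamma> (fst (\<gamma> x) m) c \<phi>"
| "satisfies N X \<gamma> x c (Next \<phi>) \<longleftrightarrow> satisfies N X \<gamma> x (global_rule N X \<gamma> c) \<phi>"

text \<open>
  The first argument fixes the type from which the index sets of disjunctions are drawn.
  Enlarging that type only adds formulas, so a span relating the two automata for disjunctions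
  of every size is a logical equivalence for each choice of \<open>'j\<close>.
\<close>

definition logical_equivalence ::
  "'j itself \<Rightarrow> 'm set \<Rightarrow>
   'x set \<Rightarrow> ('x \<Rightarrow> ('x, 'm, 's) local_structure) \<Rightarrow> 'x \<Rightarrow>
   'y set \<Rightarrow> ('y \<Rightarrow> ('y, 'm, 's) local_structure) \<Rightarrow> 'y \<Rightarrow>
   'r set \<Rightarrow> ('r \<Rightarrow> 'x \<Rightarrow> 's) \<Rightarrow> ('r \<Rightarrow> 'y \<Rightarrow> 's) \<Rightarrow> bool" where
  "logical_equivalence _ N X \<gamma> x\<^sub>0 Y \<delta> y\<^sub>0 R p\<^sub>1 p\<^sub>2 \<longleftrightarrow>
     p\<^sub>1 \<in> R \<rightarrow> configs X \<and> p\<^sub>2 \<in> R \<rightarrow> configs Y \<and>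
     (\<forall>r\<in>R. \<forall>\<phi> :: ('j, 'm, 's) modal_formula.
        satisfies N X \<gamma> x\<^sub>0 (p\<^sub>1 r) \<phi> \<longleftrightarrow> satisfies N Y \<delta> y\<^sub>0 (p\<^sub>2 r) \<phi>)"

end

theory Submission
  imports Defs
begin

text \<open>
  Let \<open>Q\<close> be the joint orbit \<open>{(\<gamma>\<^sub>1(x\<^sub>0)(m), \<delta>\<^sub>1(y\<^sub>0)(m)) | m}\<close>.  The formulas \<open>\<langle>m\<rangle>s\<close> say that
  \<open>p\<^sub>1 r\<close> and \<open>p\<^sub>2 r\<close> agree along \<open>Q\<close>, and \<open>\<langle>m\<rangle>\<circle>s\<close> that their successors do.  On \<open>Q\<close> take the
  local rule of \<open>\<gamma>\<close>.  It agrees with the local rule of \<open>\<delta>\<close>, because every local configuration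
  in the domain of the latter comes from a configuration \<open>d\<close> on \<open>Y\<close>, and \<open>p\<^sub>1 (s\<^sub>2 d)\<close> induces the
  same local configuration through \<open>\<gamma>\<close>.  Disjunctions play no role.
\<close>

lemma restrict_config_in_local_configs: "(\<lambda>n\<in>N. c (a n)) \<in> local_configs N a"
  by (auto simp: local_configs_def)

lemma local_configs_comp_subset: "local_configs N (h \<circ> a) \<subseteq> local_configs N a"
proof -
  have "(h \<circ> a) n = (h \<circ> a) n'" if "a n = a n'" for n n'
    using that by simp
  then show ?thesis
    unfolding local_configs_def by blast
qed

text \<open>Since \<open>f\<close> is constant on the fibres of \<open>a\<close> over
  \<open>N\<close>, it factors through \<open>a\<close>. This turns a question about local rules
  into one about global rules.\<close>

lemma local_config_extends:
  assumes "f \<in> local_configs N a" and "a \<in> UNIV \<rightarrow> Y"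
  obtains d where "d \<in> configs Y" and "f = (\<lambda>n\<in>N. d (a n))"
proof
  \<comment> \<open>The value at \<open>y\<close> is read at a chosen preimage in \<open>N\<close>.
    Where there is none it is arbitrary, and such a value never enters the local pattern.\<close>
  let ?d = "\<lambda>y\<in>Y. f (SOME n. n \<in> N \<and> a n = y)"
  show "?d \<in> configs Y"
    by (simp add: configs_def)
  show "f = (\<lambda>n\<in>N. ?d (a n))"
  proof
    fix n
    show "f n = (\<lambda>n\<in>N. ?d (a n)) n"
    proof (cases "n \<in> N")
      case True
      define k where "k = (SOME k. k \<in> N \<and> a k = a n)"
      have k: "k \<in> N \<and> a k = a n"
        unfolding k_def by (rule someI[of _ n]) (simp add: True)
      have agree: "\<forall>n\<in>N. \<forall>n'\<in>N. a n = a n' \<longrightarrow> f n = f n'"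
        using assms(1) unfolding local_configs_def by blast
      have "f k = f n"
        using agree k True by blast
      moreover have "?d (a n) = f k"
        using assms(2) by (auto simp: k_def)
      ultimately show ?thesis
        using True by simp
    next
      case False
      then show ?thesis
        using assms(1) PiE_arb[of f N "\<lambda>_. UNIV" n] unfolding local_configs_def by simp
    qed
  qed
qed

lemma cellular_automaton_C_obj:
  assumes "cellular_automaton N X \<gamma>" and "x \<in> X"
  shows "\<gamma> x \<in> C_obj N X"
  using assms unfolding cellular_automaton_def by blast

lemma cellular_automaton_neighbour:
  assumes "cellular_automaton N X \<gamma>" and "x \<in> X"
  shows "fst (\<gamma> x) m \<in> X"
  using cellular_automaton_C_obj[OF assms] by (cases "\<gamma> x") (simp add: C_obj_def Pi_iff)

lemma cellular_automaton_local_rule: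
  assumes "cellular_automaton N X \<gamma>" and "x \<in> X"
  shows "snd (\<gamma> x) \<in> local_configs N (fst (\<gamma> x)) \<rightarrow>\<^sub>E UNIV"
  using cellular_automaton_C_obj[OF assms] by (cases "\<gamma> x") (simp add: C_obj_def)

lemma global_rule_in_configs: "global_rule N X \<gamma> c \<in> configs X"
  by (simp add: global_rule_def configs_def)

text \<open>The morphism law makes the rule at \<open>h q\<close> a restriction of the rule at
  \<open>q\<close>, and \<open>h\<close> carries the neighbours of \<open>q\<close> to those of
  \<open>h q\<close>. Both sides thus apply the same function to the same pattern.\<close>

lemma pullback_config_global_rule:
  assumes ca: "cellular_automaton N Q \<rho>" and mor: "pre_cellular_morphism N Q \<rho> X \<gamma> h"
  shows "pullback_config Q h (global_rule N X \<gamma> c) =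
         global_rule N Q \<rho> (pullback_config Q h c)"
proof
  fix q
  show "pullback_config Q h (global_rule N X \<gamma> c) q =
        global_rule N Q \<rho> (pullback_config Q h c) q"
  proof (cases "q \<in> Q")
    case True
    let ?a = "fst (\<rho> q)"
    have hq: "h q \<in> X"
      using mor True by (auto simp: pre_cellular_morphism_def)
    have \<gamma>: "\<gamma> (h q) = (h \<circ> ?a, restrict (snd (\<rho> q)) (local_configs N (h \<circ> ?a)))"
      using mor True by (auto simp: pre_cellular_morphism_def C_map_def case_prod_beta)
    \<comment> \<open>A pattern induced by \<open>c\<close> lies in the smaller domain, so the
      restriction in \<open>C_map\<close> does not change the value taken here.\<close>
    have mem: "(\<lambda>n\<in>N. c (h (?a n))) \<in> local_configs N (h \<circ> ?a)"
      using restrict_config_in_local_configs[of c "h \<circ> ?a" N] by simp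
    \<comment> \<open>The neighbours of \<open>q\<close> stay in \<open>Q\<close>, where the
      normalised composite is the plain one.\<close>
    have "(\<lambda>n\<in>N. compose Q c h (?a n)) = (\<lambda>n\<in>N. c (h (?a n)))"
      using cellular_automaton_neighbour[OF ca True] by (auto simp: compose_def)
    then show ?thesis
      using True hq \<gamma> mem by (simp add: pullback_config_def global_rule_def compose_eq)
  next
    case False
    then show ?thesis
      by (simp add: pullback_config_def global_rule_def compose_def)
  qed
qed

text \<open>Both global rules pull back to the global rule of \<rho> on one common configuration
  over \<open>Q\<close>, so a step preserves consistency.\<close>

lemma consistent_configs_bisimulation:
  assumes ca: "cellular_automaton N Q \<rho>"
    and q\<^sub>1: "pre_cellular_morphism N Q \<rho> X \<gamma> q\<^sub>1" and q\<^sub>2: "pre_cellular_morphism N Q \<rho> Y \<delta> q\<^sub>2"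
  shows "cellular_bisimulation N X \<gamma> Y \<delta> Q \<rho> q\<^sub>1 q\<^sub>2
           (consistent_configs X Y Q q\<^sub>1 q\<^sub>2) fst snd
           (\<lambda>(c\<^sub>1, c\<^sub>2). (global_rule N X \<gamma> c\<^sub>1, global_rule N Y \<delta> c\<^sub>2))"
  using assms
  by (auto simp: cellular_bisimulation_def consistent_configs_def global_rule_in_configs
      pullback_config_global_rule[OF ca q\<^sub>1] pullback_config_global_rule[OF ca q\<^sub>2])

text \<open>Prefixing a formula with \<open>Dia m\<close> moves both base points at once. This
  carries facts about the base points to the whole joint orbit.\<close>

lemma logical_equivalence_neighbour:
  fixes p\<^sub>1 :: "'r \<Rightarrow> 'x \<Rightarrow> 's" and \<gamma> :: "'x \<Rightarrow> ('x, 'm, 's) local_structure"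
  assumes eq: "logical_equivalence TYPE('j) N X \<gamma> x Y \<delta> y R p\<^sub>1 p\<^sub>2"
  shows "logical_equivalence TYPE('j) N X \<gamma> (fst (\<gamma> x) m) Y \<delta> (fst (\<delta> y) m) R p\<^sub>1 p\<^sub>2"
proof -
  have "satisfies N X \<gamma> (fst (\<gamma> x) m) (p\<^sub>1 r) \<phi> \<longleftrightarrow> satisfies N Y \<delta> (fst (\<delta> y) m) (p\<^sub>2 r) \<phi>"
    if "r \<in> R" for r and \<phi> :: "('j, 'm, 's) modal_formula"
  proof -
    have "satisfies N X \<gamma> x (p\<^sub>1 r) (Dia m \<phi>) \<longleftrightarrow> satisfies N Y \<delta> y (p\<^sub>2 r) (Dia m \<phi>)"
      using eq that unfolding logical_equivalence_def by blast
    then show ?thesis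
      by simp
  qed
  then show ?thesis
    using eq by (simp add: logical_equivalence_def)
qed

text \<open>The state tested is the one occurring on the right, so the formula is true there and
  hence on the left.\<close>

lemma logical_equivalence_state:
  assumes "logical_equivalence TYPE('j) N X \<gamma> x Y \<delta> y R p\<^sub>1 p\<^sub>2" and "r \<in> R"
  shows "p\<^sub>1 r x = p\<^sub>2 r y"
proof -
  have "satisfies N X \<gamma> x (p\<^sub>1 r) (State (p\<^sub>2 r y) :: ('j, _, _) modal_formula) \<longleftrightarrow>
        satisfies N Y \<delta> y (p\<^sub>2 r) (State (p\<^sub>2 r y) :: ('j, _, _) modal_formula)"
    using assms unfolding logical_equivalence_def by blast
  then show ?thesis
    by simp
qed

lemma logical_equivalence_next_state:
  assumes "logical_equivalence TYPE('j) N X \<gamma> x Y \<delta> y R p\<^sub>1 p\<^sub>2" and "r \<in> R"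
  shows "global_rule N X \<gamma> (p\<^sub>1 r) x = global_rule N Y \<delta> (p\<^sub>2 r) y"
proof -
  let ?\<phi> = "Next (State (global_rule N Y \<delta> (p\<^sub>2 r) y)) :: ('j, _, _) modal_formula"
  have "satisfies N X \<gamma> x (p\<^sub>1 r) ?\<phi> \<longleftrightarrow> satisfies N Y \<delta> y (p\<^sub>2 r) ?\<phi>"
    using assms unfolding logical_equivalence_def by blast
  then show ?thesis
    by simp
qed

lemma logical_equivalence_local_rule:
  fixes \<delta> :: "'y \<Rightarrow> ('y, 'm::monoid_mult, 's) local_structure"
  assumes \<delta>: "cellular_automaton N Y \<delta>" and x: "x \<in> X" and y: "y \<in> Y"
    and eq: "logical_equivalence TYPE('j) N X \<gamma> x Y \<delta> y R p\<^sub>1 p\<^sub>2"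
    and s\<^sub>2: "s\<^sub>2 \<in> configs Y \<rightarrow> R" "\<forall>d\<in>configs Y. p\<^sub>2 (s\<^sub>2 d) = d"
  shows "restrict (snd (\<gamma> x)) (local_configs N (fst (\<delta> y))) = snd (\<delta> y)"
proof (rule extensionalityI[of _ "local_configs N (fst (\<delta> y))"])
  show "snd (\<delta> y) \<in> extensional (local_configs N (fst (\<delta> y)))"
    using cellular_automaton_local_rule[OF \<delta> y] by (simp add: PiE_def)
  fix f :: "'m \<Rightarrow> 's"
  assume f: "f \<in> local_configs N (fst (\<delta> y))"
  obtain d :: "'y \<Rightarrow> 's" where d: "d \<in> configs Y" and fd: "f = (\<lambda>n\<in>N. d (fst (\<delta> y) n))"
    using local_config_extends[OF f, of Y] cellular_automaton_neighbour[OF \<delta> y] by blast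
  \<comment> \<open>The section realises the arbitrary \<open>d\<close> by an index in
    \<open>R\<close>. Moving the equivalence along each \<open>n\<close> then shows that the first
    leg at \<open>r\<close> induces through \<gamma> the pattern \<open>f\<close> itself.\<close>
  define r where "r = s\<^sub>2 d"
  have r: "r \<in> R" "p\<^sub>2 r = d"
    using s\<^sub>2 d by (auto simp: r_def)
  have "p\<^sub>1 r (fst (\<gamma> x) n) = d (fst (\<delta> y) n)" for n
    using logical_equivalence_state[OF logical_equivalence_neighbour[OF eq] r(1)] r(2) by simp
  then have "snd (\<gamma> x) f = global_rule N X \<gamma> (p\<^sub>1 r) x"
    using x by (simp add: global_rule_def fd)
  also have "\<dots> = global_rule N Y \<delta> d y"
    using logical_equivalence_next_state[OF eq r(1)] r(2) by simp
  also have "\<dots> = snd (\<delta> y) f"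
    using y by (simp add: global_rule_def fd)
  finally show "restrict (snd (\<gamma> x)) (local_configs N (fst (\<delta> y))) f = snd (\<delta> y) f"
    using f by simp
qed simp

theorem theorem4:
  fixes N :: "'m::monoid_mult set"
    and X :: "'x set" and \<gamma> :: "'x \<Rightarrow> ('x, 'm, 's) local_structure" and x\<^sub>0 :: 'x
    and Y :: "'y set" and \<delta> :: "'y \<Rightarrow> ('y, 'm, 's) local_structure" and y\<^sub>0 :: 'y
    and R :: "'r set" and p\<^sub>1 :: "'r \<Rightarrow> 'x \<Rightarrow> 's" and p\<^sub>2 :: "'r \<Rightarrow> 'y \<Rightarrow> 's"
    and s\<^sub>2 :: "('y \<Rightarrow> 's) \<Rightarrow> 'r"
  assumes "based_cellular_automaton N X \<gamma> x\<^sub>0"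
    and "based_cellular_automaton N Y \<delta> y\<^sub>0"
    and "logical_equivalence TYPE('j) N X \<gamma> x\<^sub>0 Y \<delta> y\<^sub>0 R p\<^sub>1 p\<^sub>2"
    and "s\<^sub>2 \<in> configs Y \<rightarrow> R"
    and "\<forall>d\<in>configs Y. p\<^sub>2 (s\<^sub>2 d) = d"
  shows "\<exists>(Q :: ('x \<times> 'y) set) (\<rho> :: 'x \<times> 'y \<Rightarrow> ('x \<times> 'y, 'm, 's) local_structure)
           (h :: 'r \<Rightarrow> ('x \<Rightarrow> 's) \<times> ('y \<Rightarrow> 's)).
           Q \<subseteq> X \<times> Y \<and> (x\<^sub>0, y\<^sub>0) \<in> Q \<and>
           cellular_automaton N Q \<rho> \<and>
           pre_cellular_morphism N Q \<rho> X \<gamma> fst \<and>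
           pre_cellular_morphism N Q \<rho> Y \<delta> snd \<and>
           cellular_bisimulation N X \<gamma> Y \<delta> Q \<rho> fst snd
             (consistent_configs X Y Q fst snd) fst snd
             (\<lambda>(c\<^sub>1, c\<^sub>2). (global_rule N X \<gamma> c\<^sub>1, global_rule N Y \<delta> c\<^sub>2)) \<and>
           h \<in> R \<rightarrow> consistent_configs X Y Q fst snd \<and>
           (\<forall>r\<in>R. fst (h r) = p\<^sub>1 r \<and> snd (h r) = p\<^sub>2 r)"
proof -
  have \<gamma>: "cellular_automaton N X \<gamma>" and x\<^sub>0: "x\<^sub>0 \<in> X"
    and \<delta>: "cellular_automaton N Y \<delta>" and y\<^sub>0: "y\<^sub>0 \<in> Y"
    using assms(1,2) by (auto simp: based_cellular_automaton_def)
  note eq = assms(3)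
  define Q where "Q = range (\<lambda>m. (fst (\<gamma> x\<^sub>0) m, fst (\<delta> y\<^sub>0) m))"
  define a where "a = (\<lambda>(x, y) m. (fst (\<gamma> x) m, fst (\<delta> y) m))"
  \<comment> \<open>The fibres of \<open>a q\<close> are finer than those of either component, so
    this domain can exceed that of the rule of \<gamma>. On the excess the value is
    \<open>undefined\<close>; both projections discard it.\<close>
  define \<rho> where "\<rho> = (\<lambda>q. (a q, restrict (snd (\<gamma> (fst q))) (local_configs N (a q))))"
  have QXY: "Q \<subseteq> X \<times> Y"
    using cellular_automaton_neighbour[OF \<gamma> x\<^sub>0] cellular_automaton_neighbour[OF \<delta> y\<^sub>0]
    by (auto simp: Q_def)
  have unit: "fst (\<gamma> x) 1 = x" if "x \<in> X" for x
    using \<gamma> that by (simp add: cellular_automaton_def)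
  have unit': "fst (\<delta> y) 1 = y" if "y \<in> Y" for y
    using \<delta> that by (simp add: cellular_automaton_def)
  have mult: "fst (\<gamma> (fst (\<gamma> x) m)) n = fst (\<gamma> x) (n * m)" if "x \<in> X" for x m n
    using \<gamma> that by (simp add: cellular_automaton_def)
  have mult': "fst (\<delta> (fst (\<delta> y) m)) n = fst (\<delta> y) (n * m)" if "y \<in> Y" for y m n
    using \<delta> that by (simp add: cellular_automaton_def)
  have base: "(x\<^sub>0, y\<^sub>0) \<in> Q"
    unfolding Q_def by (rule range_eqI[of _ _ 1]) (simp add: unit unit' x\<^sub>0 y\<^sub>0)
  \<comment> \<open>The neighbour at \<open>m\<close> of the orbit point at \<open>k\<close> is the
    orbit point at \<open>m * k\<close>, for both components simultaneously.\<close>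
  have aQ: "a q m \<in> Q" if "q \<in> Q" for q m
    using that x\<^sub>0 y\<^sub>0 by (auto simp: Q_def a_def mult mult')
  have ca: "cellular_automaton N Q \<rho>"
    unfolding cellular_automaton_def
  proof (intro conjI ballI allI)
    show "\<rho> \<in> Q \<rightarrow> C_obj N Q"
      using aQ by (auto simp: \<rho>_def C_obj_def)
  next
    fix q assume "q \<in> Q"
    then show "fst (\<rho> q) 1 = q"
      using QXY unit unit' by (auto simp: \<rho>_def a_def)
  next
    fix q m n assume "q \<in> Q"
    then show "fst (\<rho> (fst (\<rho> q) m)) n = fst (\<rho> q) (n * m)"
      using QXY mult mult' by (auto simp: \<rho>_def a_def)
  qed
  have comp: "fst \<circ> a q = fst (\<gamma> (fst q))" "snd \<circ> a q = fst (\<delta> (snd q))" for q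
    by (auto simp: a_def split: prod.split)
  \<comment> \<open>The map \<open>h \<circ> a q\<close> has coarser fibres than \<open>a q\<close>,
    so of the two nested restrictions only the one to the smaller set remains. The free result type
    of \<open>h\<close> serves both projections.\<close>
  have C_map_\<rho>: "C_map N h (\<rho> q) =
      (h \<circ> a q, restrict (snd (\<gamma> (fst q))) (local_configs N (h \<circ> a q)))"
    for h :: "'x \<times> 'y \<Rightarrow> 'z" and q
    by (simp add: C_map_def \<rho>_def Int_absorb1[OF local_configs_comp_subset])
  have fst_mor: "pre_cellular_morphism N Q \<rho> X \<gamma> fst"
    unfolding pre_cellular_morphism_def
  proof (intro conjI ballI)
    show "fst \<in> Q \<rightarrow> X"
      using QXY by auto
    fix q assume "q \<in> Q"
    \<comment> \<open>The rule of \<gamma> is already normalised outside its domain, so restricting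
      it there returns it exactly.\<close>
    then have "snd (\<gamma> (fst q)) \<in> extensional (local_configs N (fst (\<gamma> (fst q))))"
      using QXY cellular_automaton_local_rule[OF \<gamma>] by (auto simp: PiE_def)
    then show "C_map N fst (\<rho> q) = \<gamma> (fst q)"
      by (simp add: C_map_\<rho> comp extensional_restrict)
  qed
  have snd_mor: "pre_cellular_morphism N Q \<rho> Y \<delta> snd"
    unfolding pre_cellular_morphism_def
  proof (intro conjI ballI)
    show "snd \<in> Q \<rightarrow> Y"
      using QXY by auto
    fix q assume q: "q \<in> Q"
    \<comment> \<open>Membership in \<open>Q\<close> yields a single \<open>m\<close> leading to
      both components, so the equivalence at the base points transfers to \<open>q\<close>.\<close>
    then have "logical_equivalence TYPE('j) N X \<gamma> (fst q) Y \<delta> (snd q) R p\<^sub>1 p\<^sub>2"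
      using logical_equivalence_neighbour[OF eq] by (auto simp: Q_def)
    then have "restrict (snd (\<gamma> (fst q))) (local_configs N (fst (\<delta> (snd q)))) = snd (\<delta> (snd q))"
      using q QXY assms(4,5) by (intro logical_equivalence_local_rule[OF \<delta>]) auto
    then show "C_map N snd (\<rho> q) = \<delta> (snd q)"
      by (simp add: C_map_\<rho> comp)
  qed
  have "(\<lambda>r. (p\<^sub>1 r, p\<^sub>2 r)) \<in> R \<rightarrow> consistent_configs X Y Q fst snd"
  proof
    fix r assume r: "r \<in> R"
    have "p\<^sub>1 r (fst q) = p\<^sub>2 r (snd q)" if "q \<in> Q" for q
      using that logical_equivalence_state[OF logical_equivalence_neighbour[OF eq] r]
      by (auto simp: Q_def)
    then have "pullback_config Q fst (p\<^sub>1 r) = pullback_config Q snd (p\<^sub>2 r)"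
      by (auto simp: pullback_config_def compose_def)
    then show "(p\<^sub>1 r, p\<^sub>2 r) \<in> consistent_configs X Y Q fst snd"
      using eq r by (auto simp: consistent_configs_def logical_equivalence_def)
  qed
  then show ?thesis
    using QXY base ca fst_mor snd_mor consistent_configs_bisimulation[OF ca fst_mor snd_mor]
    by (intro exI[of _ Q] exI[of _ \<rho>] exI[of _ "\<lambda>r. (p\<^sub>1 r, p\<^sub>2 r)"]) simp
qed

end
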